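(* Let $\tau\in\mathbb{C}$ with $\operatorname{Im}(\tau)>0$ and $q=e^{2\pi i\tau}$. Then $$\frac{\eta(6\tau)^5}{\eta(3\tau)^2}=\sum_{n=1}^{\infty}\left(2\left(\frac{n}{12}\right)-\left(\frac{n}{3}\right)\right)n\,q^{n^2}.$$
   Context: For $\operatorname{Im}(\tau)>0$ and $q=e^{2\pi i\tau}$, Dedekind's eta function is $\eta(\tau)=q^{1/24}\prod_{n=1}^{\infty}(1-q^n)$, where $q^{1/24}=e^{2\pi i\tau/24}$; $\eta(k\tau)^j$ denotes the $j$-th power of $\eta(k\tau)$. The symbol $\left(\frac{a}{m}\right)$, for an integer $a$ and a positive integer $m$, is the Kronecker symbol: $\left(\frac{a}{1}\right)=1$; for an odd prime $p$, $\left(\frac{a}{p}\right)$ is the Legendre symbol ($0$ if $p\mid a$, $1$ if $a$ is a nonzero quadratic residue mod $p$, $-1$ otherwise); $\left(\frac{a}{2}\right)=0$ if $a$ is even, $1$ if $a\equiv\pm1\pmod 8$, $-1$ if $a\equiv\pm3\pmod 8$; and $\left(\frac{a}{m}\right)=\prod_{i=1}^{s}\left(\frac{a}{p_i}\right)$ if $m=\prod_{i=1}^{s}p_i$ is the factorization of $m$ into primes (with repetition). Thus $\left(\frac{n}{12}\right)=\left(\frac{n}{2}\right)^2\left(\frac{n}{3}\right)$. *)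

theory Defs
  imports "HOL-Analysis.Analysis" "HOL-Number_Theory.Number_Theory"
begin

(* Only meaningful on the upper half plane, where the product converges.  As prodinf is indexed
   from 0, the factor with index n is 1 - q^(n+1). *)
definition dedekind_eta :: "complex \<Rightarrow> complex" where
  "dedekind_eta \<tau> =
     exp (2 * of_real pi * \<i> * \<tau> / 24) *
     (\<Prod>n. 1 - exp (2 * of_real pi * \<i> * \<tau>) ^ Suc n)"

definition kronecker_prime :: "int \<Rightarrow> nat \<Rightarrow> int" where
  "kronecker_prime a p =
     (if p = 2 then
        (if even a then 0
         else if [a = 1] (mod 8) \<or> [a = -1] (mod 8) then 1
         else -1)
      else Legendre a (int p))"

(* Kronecker symbol with positive lower argument; the value 1 at m = 0 is junk. *)
definition kronecker :: "int \<Rightarrow> nat \<Rightarrow> int" where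
  "kronecker a m = (\<Prod>p\<in>#prime_factorization m. kronecker_prime a p)"

end

theory Submission
  imports Defs
begin

text \<open>
  Put \<open>Q = q\<^sup>3\<close>. After cancelling the factor \<open>q\<close>, the claim is that
  \<open>(Q\<^sup>2; Q\<^sup>2)\<^sup>5 / (Q; Q)\<^sup>2\<close> (infinite \<open>q\<close>-Pochhammer symbols) equals the sum of
  \<open>(-1)^k (3k+1) Q^(3k\<^sup>2+2k)\<close> over all integers \<open>k\<close>. This is the derivative of the quintuple product
  identity, with base \<open>Q\<^sup>2\<close>, at the zero \<open>x = Q\<close> of its product side. The derivative is taken by
  setting \<open>x = Q y\<close>, dividing by \<open>1 - 1/y\<^sup>2\<close> and letting \<open>y \<rightarrow> 1\<close>: pairing the indices \<open>k\<close> and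
  \<open>-1-k\<close> turns the quotients into geometric sums, whose values at \<open>y = 1\<close> are the weights.

  The quintuple product identity is the limit of a finite form due to Chen, Chu and Gu, in which a
  sum of \<open>m + 1\<close> rational functions is identically 1. The finite form follows by induction on \<open>m\<close>
  from a Wilf--Zeilberger pair; replacing \<open>x\<close> by \<open>x q^(-a)\<close> with \<open>m = 2a - 1\<close> makes the sum
  bilateral, and Tannery's theorem gives the limit.
\<close>

section \<open>Finite form of the quintuple product identity\<close>

definition qpoch :: "'a::comm_ring_1 \<Rightarrow> 'a \<Rightarrow> nat \<Rightarrow> 'a" where
  "qpoch a q n = (\<Prod>k<n. 1 - a * q ^ k)"

lemma qpoch_0 [simp]: "qpoch a q 0 = 1"
  by (simp add: qpoch_def)

lemma qpoch_Suc: "qpoch a q (Suc n) = qpoch a q n * (1 - a * q ^ n)"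
  by (simp add: qpoch_def)

lemma qpoch_add: "qpoch a q (m + n) = qpoch a q m * qpoch (a * q ^ m) q n"
  by (induction n) (simp_all add: qpoch_Suc power_add mult_ac)

text \<open>Both sides equal \<open>qpoch a q (Suc n)\<close>, with the first or the last factor
  split off.\<close>

lemma qpoch_shift: "qpoch (a * q) q n * (1 - a) = qpoch a q n * (1 - a * q ^ n)"
  using qpoch_add[of a q 1 n] qpoch_Suc[of a q n] by (simp add: qpoch_Suc mult_ac)

lemma qpoch_eq_0_iff: "qpoch (a::'a::idom) q n = 0 \<longleftrightarrow> (\<exists>k<n. a * q ^ k = 1)"
  by (auto simp: qpoch_def)

text \<open>The explicit 0 matters: for \<open>k > n\<close> the truncated difference
  \<open>n - k\<close> would leave a quotient that need not vanish.\<close>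

definition qbinom :: "'a::field \<Rightarrow> nat \<Rightarrow> nat \<Rightarrow> 'a" where
  "qbinom q n k = (if k \<le> n then qpoch q q n / (qpoch q q k * qpoch q q (n - k)) else 0)"

definition quintuple_summand :: "'a::field \<Rightarrow> 'a \<Rightarrow> nat \<Rightarrow> nat \<Rightarrow> 'a" where
  "quintuple_summand q x m k = (1 + x * q ^ k) * qbinom q m k * qpoch x q (Suc m) / qpoch (x\<^sup>2 * q ^ k) q (Suc m)
                * x ^ k * q ^ (k\<^sup>2)"

text \<open>The Wilf--Zeilberger partner of the summand, with its poles at the zeros of
  \<open>q^k - q^(m+1)\<close> and \<open>1 + x q^k\<close> cancelled against factors of the summand.\<close>
definition quintuple_certificate :: "'a::field \<Rightarrow> 'a \<Rightarrow> nat \<Rightarrow> nat \<Rightarrow> 'a" where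
  "quintuple_certificate q x m k = (case k of 0 \<Rightarrow> 0 | Suc l \<Rightarrow>
      - (q ^ (m + k) * qbinom q m l * qpoch x q (Suc m) / qpoch (x\<^sup>2 * q ^ k) q (Suc m)
          * x ^ k * q ^ (l\<^sup>2)))"

context
  fixes q :: "'a::field"
  assumes not_root: "\<And>n. n > 0 \<Longrightarrow> q ^ n \<noteq> 1"
begin

lemma qpoch_self_nonzero: "qpoch q q n \<noteq> 0"
  using not_root[of "Suc _"] by (simp add: qpoch_eq_0_iff)

lemma qbinom_0: "qbinom q n 0 = 1"
  by (simp add: qbinom_def qpoch_self_nonzero)

text \<open>Cross-multiplied ratio of neighbouring q-binomials. This form also covers
  \<open>k = n\<close>, where both sides vanish.\<close>

lemma qbinom_Suc_right:
  assumes "k \<le> n"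
  shows "qbinom q n (Suc k) * (1 - q ^ Suc k) = qbinom q n k * (1 - q ^ (n - k))"
proof (cases "k = n")
  case False
  with assms have "n - k = Suc (n - Suc k)" by simp
  with False assms show ?thesis
    using qpoch_self_nonzero[of k] qpoch_self_nonzero[of "n - Suc k"]
      not_root[of "Suc k"] not_root[of "n - k"]
    by (simp add: qbinom_def qpoch_Suc field_simps)
qed (simp add: qbinom_def)

lemma qbinom_Suc_Suc:
  assumes "k \<le> n"
  shows "qbinom q (Suc n) (Suc k) * (1 - q ^ Suc k) = qbinom q n k * (1 - q ^ Suc n)"
  using assms qpoch_self_nonzero[of k] qpoch_self_nonzero[of "n - k"] not_root[of "Suc k"]
  by (simp add: qbinom_def qpoch_Suc field_simps)

text \<open>Read with \<open>K = q^(l+1)\<close>, \<open>D = q^(m-l)\<close>, and \<open>b\<close>, \<open>b1\<close>, \<open>b2\<close> the \<open>q\<close>-binomials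
  \<open>(m, l)\<close>, \<open>(m, l+1)\<close>, \<open>(m+1, l+1)\<close>.\<close>
lemma quintuple_wz_identity:
  fixes x K D :: 'a
  assumes "b1 * (1 - K) = b * (1 - D)" "b2 * (1 - K) = b * (1 - D * K)" "K \<noteq> 1"
  shows "(1 + x * K) * b2 * (1 - x * (D * K)) - (1 + x * K) * b1 * (1 - x\<^sup>2 * K * (D * K))
         = - (b1 * D * K * K * x * (1 - K * x\<^sup>2)) + D * b * (1 - x\<^sup>2 * K * (D * K))" (is "?l = ?r")
proof -
  \<comment> \<open>Multiplying by \<open>1 - K\<close> lets the assumptions express
    \<open>b1\<close> and \<open>b2\<close> through \<open>b\<close>; a polynomial identity
    remains.\<close>
  have "?l * (1 - K) = (1 + x * K) * (b2 * (1 - K)) * (1 - x * (D * K)) - (1 + x * K) * (b1 * (1 - K)) * (1 - x\<^sup>2 * K * (D * K))"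
    by (simp add: algebra_simps power2_eq_square)
  also have "\<dots> = - ((b1 * (1 - K)) * D * K * K * x * (1 - K * x\<^sup>2)) + D * b * (1 - x\<^sup>2 * K * (D * K)) * (1 - K)"
    unfolding assms by (simp add: algebra_simps power2_eq_square)
  also have "\<dots> = ?r * (1 - K)" by (simp add: algebra_simps power2_eq_square)
  finally show ?thesis using assms(3) by simp
qed

text \<open>All four terms share the factor \<open>C\<close> of the proof. Their cofactors satisfy a
  polynomial identity in \<open>x\<close>, two powers of \<open>q\<close> and three q-binomials. The
  case \<open>k = 0\<close> is separate because the certificate is 0 there by definition.\<close>

lemma quintuple_summand_wz:
  assumes nz: "\<And>n. x\<^sup>2 * q ^ n \<noteq> 1" and "k \<le> Suc m"
  shows "quintuple_summand q x (Suc m) k - quintuple_summand q x m k = quintuple_certificate q x m (Suc k) - quintuple_certificate q x m k"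
proof -
  define P where "P = qpoch (x\<^sup>2 * q ^ k) q (Suc m)"
  define P' where "P' = qpoch (x\<^sup>2 * q ^ Suc k) q (Suc m)"
  define X where "X = qpoch x q (Suc m)"
  define e where "e = 1 - x\<^sup>2 * q ^ k * q ^ Suc m"
  define C where "C = X * x ^ k * q ^ (k\<^sup>2) / (P * e)"
  have P: "P \<noteq> 0" "P' \<noteq> 0"
    using nz by (auto simp: P_def P'_def qpoch_eq_0_iff mult.assoc simp flip: power_add power_Suc)
  have e: "e \<noteq> 0" 
    using nz[of "k + Suc m"] by (auto simp: e_def power_add mult_ac)
  \<comment> \<open>The products \<open>P\<close> and \<open>P'\<close> overlap in all but their end
    factors.\<close>
  have PP: "P' * (1 - x\<^sup>2 * q ^ k) = P * e"
    using qpoch_shift[of "x\<^sup>2 * q ^ k" q "Suc m"] unfolding P_def P'_def e_def by (simp add: mult_ac)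
  have d: "1 - x\<^sup>2 * q ^ k \<noteq> 0" using nz[of k] by simp
  have F1: "quintuple_summand q x m k = C * ((1 + x * q ^ k) * qbinom q m k * e)"
    unfolding quintuple_summand_def P_def[symmetric] X_def[symmetric] C_def using P e by (simp add: field_simps)
  have F2: "quintuple_summand q x (Suc m) k = C * ((1 + x * q ^ k) * qbinom q (Suc m) k * (1 - x * q ^ Suc m))"
    unfolding quintuple_summand_def qpoch_Suc[of _ _ "Suc m"] P_def[symmetric] X_def[symmetric] e_def[symmetric]
      C_def using P e by (simp add: field_simps)
  have inv: "1 / P' = (1 - x\<^sup>2 * q ^ k) / (P * e)"
    using PP P e d by (simp add: field_simps)
  have "quintuple_certificate q x m (Suc k) = - (q ^ (m + Suc k) * qbinom q m k * X * x ^ Suc k * q ^ (k\<^sup>2) * (1 / P'))"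
    unfolding quintuple_certificate_def P'_def[symmetric] X_def[symmetric] by simp
  also have "\<dots> = - (C * (qbinom q m k * q ^ Suc m * q ^ k * x * (1 - q ^ k * x\<^sup>2)))"
    unfolding inv C_def by (simp add: power_add mult_ac)
  finally have G1: "quintuple_certificate q x m (Suc k) = \<dots>" .
  show ?thesis
  proof (cases k)
    case 0
    have "quintuple_summand q x (Suc m) k - quintuple_summand q x m k - quintuple_certificate q x m (Suc k) + quintuple_certificate q x m k
       = C * ((1 + x) * (1 - x * q ^ Suc m) - (1 + x) * e + q ^ Suc m * x * (1 - x\<^sup>2))"
      unfolding F1 F2 G1 using 0 by (simp add: qbinom_0 quintuple_certificate_def algebra_simps)
    also have "(1 + x) * (1 - x * q ^ Suc m) - (1 + x) * e + q ^ Suc m * x * (1 - x\<^sup>2) = 0"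
      unfolding e_def using 0 by (simp add: algebra_simps power2_eq_square)
    finally show ?thesis by (simp add: algebra_simps)
  next
    case (Suc l)
    define D where "D = q ^ (m - l)"
    define K where "K = q ^ k"
    have l: "l \<le> m" using assms Suc by simp
    have DK: "q ^ Suc m = D * K"
      unfolding D_def K_def Suc power_add[symmetric] using l by (simp add: power_add[symmetric] del: power_Suc)
    \<comment> \<open>With \<open>k = l + 1\<close> this is the equality
      \<open>m + k + l^2 = (m - l) + k^2\<close> of exponents.\<close>
    have sq: "q ^ (m + k) * q ^ (l\<^sup>2) = D * q ^ (k\<^sup>2)"
      unfolding D_def power_add[symmetric] Suc using l 
      by (intro arg_cong[where f="\<lambda>n. q ^ n"]) (simp add: power2_eq_square)
    have "quintuple_certificate q x m k = - (q ^ (m + k) * q ^ (l\<^sup>2) * qbinom q m l * X * x ^ k / P)"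
      unfolding P_def X_def by (simp add: quintuple_certificate_def Suc)
    also have "\<dots> = - (C * (D * qbinom q m l * e))"
      unfolding sq C_def using P e by (simp add: field_simps)
    finally have G2: "quintuple_certificate q x m k = \<dots>" .
    have eK: "e = 1 - x\<^sup>2 * K * (D * K)" unfolding e_def DK K_def ..
    have *: "(1 + x * K) * qbinom q (Suc m) k * (1 - x * (D * K)) - (1 + x * K) * qbinom q m k * e
         = - (qbinom q m k * D * K * K * x * (1 - K * x\<^sup>2)) + D * qbinom q m l * e"
      unfolding eK
    proof (rule quintuple_wz_identity)
      show "qbinom q m k * (1 - K) = qbinom q m l * (1 - D)"
        using qbinom_Suc_right[OF l] by (simp add: K_def D_def Suc)
      show "qbinom q (Suc m) k * (1 - K) = qbinom q m l * (1 - D * K)"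
        using qbinom_Suc_Suc[OF l] unfolding DK by (simp add: K_def Suc)
      show "K \<noteq> 1" using not_root[of k] Suc by (simp add: K_def)
    qed
    have "quintuple_summand q x (Suc m) k - quintuple_summand q x m k - quintuple_certificate q x m (Suc k) + quintuple_certificate q x m k = 
       C * (((1 + x * K) * qbinom q (Suc m) k * (1 - x * (D * K)) - (1 + x * K) * qbinom q m k * e)
         - (- (qbinom q m k * D * K * K * x * (1 - K * x\<^sup>2)) + D * qbinom q m l * e))"
      unfolding F1 F2 G1 G2 DK K_def[symmetric] by (simp add: algebra_simps)
    also have "\<dots> = 0" unfolding * by simp
    finally show ?thesis by (simp add: algebra_simps)
  qed
qed

theorem finite_quintuple_product:
  assumes nz: "\<And>n. x\<^sup>2 * q ^ n \<noteq> 1"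
  shows "(\<Sum>k\<le>m. quintuple_summand q x m k) = 1"
proof (induction m)
  case 0
  have "x \<noteq> 1" "x\<^sup>2 \<noteq> 1" using nz[of 0] by auto
  then show ?case
    by (simp add: quintuple_summand_def qbinom_0 qpoch_Suc power2_eq_square) (simp add: field_simps)
next
  case (Suc m)
  have "(\<Sum>k\<le>Suc m. quintuple_summand q x (Suc m) k) - (\<Sum>k\<le>Suc m. quintuple_summand q x m k) = (\<Sum>k<Suc (Suc m). quintuple_certificate q x m (Suc k) - quintuple_certificate q x m k)"
    unfolding sum_subtractf[symmetric] lessThan_Suc_atMost
    by (intro sum.cong refl quintuple_summand_wz nz) auto
  also have "\<dots> = quintuple_certificate q x m (Suc (Suc m)) - quintuple_certificate q x m 0" by (rule sum_lessThan_telescope)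
  \<comment> \<open>At the upper end the certificate contains the q-binomial
    \<open>(m, m+1)\<close>, which is 0.\<close>
  also have "\<dots> = 0" by (simp add: quintuple_certificate_def qbinom_def)
  finally have "(\<Sum>k\<le>Suc m. quintuple_summand q x (Suc m) k) = (\<Sum>k\<le>Suc m. quintuple_summand q x m k)" by simp
  also have "\<dots> = (\<Sum>k\<le>m. quintuple_summand q x m k)" by (simp add: quintuple_summand_def qbinom_def)
  finally show ?case using Suc.IH by simp
qed

end

section \<open>The bilateral form and its limit\<close>

text \<open>Each factor \<open>1 - a / q^j\<close>, for \<open>j\<close> from 1 to \<open>n\<close>,
  equals \<open>- (a / q^j) * (1 - q^j / a)\<close>; the exponents \<open>j\<close> add up to the
  binomial coefficient.\<close>

lemma qpoch_reflect:
  fixes a q :: "'a::field"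
  assumes "a \<noteq> 0" "q \<noteq> 0"
  shows "qpoch (a / q ^ n) q n * q ^ (Suc n choose 2) = (- a) ^ n * qpoch (q / a) q n"
proof (induction n)
  case (Suc n)
  have c: "Suc (Suc n) choose 2 = (Suc n choose 2) + Suc n"
    by (simp add: numeral_2_eq_2)
  have "qpoch (a / q ^ Suc n) q (Suc n) = (1 - a / q ^ Suc n) * qpoch (a / q ^ n) q n"
    using qpoch_add[of "a / q ^ Suc n" q 1 n] assms by (simp add: qpoch_Suc)
  then have "qpoch (a / q ^ Suc n) q (Suc n) * q ^ (Suc (Suc n) choose 2)
      = (1 - a / q ^ Suc n) * q ^ Suc n * (qpoch (a / q ^ n) q n * q ^ (Suc n choose 2))"
    unfolding c power_add by (simp add: mult_ac)
  also have "\<dots> = (q ^ Suc n - a) * ((- a) ^ n * qpoch (q / a) q n)"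
    unfolding Suc.IH using assms by (simp add: field_simps)
  also have "\<dots> = (- a) ^ Suc n * qpoch (q / a) q (Suc n)"
    using assms by (simp add: qpoch_Suc field_simps)
  finally show ?case .
qed (simp add: binomial_eq_0)

text \<open>General term of the bilateral quintuple product series. The division is exact, as
  \<open>k * (3 * k - 1)\<close> is even.\<close>

definition quintuple_term :: "'a::field \<Rightarrow> 'a \<Rightarrow> int \<Rightarrow> 'a" where
  "quintuple_term q x k =
     (-1) powi k * x powi (3 * k) * q powi (k * (3 * k - 1) div 2) * (1 + x * q powi k)"

text \<open>What remains of the recentred summand after the limiting term is split off. As
  \<open>a\<close>, \<open>i\<close> and \<open>2 * a - 1 - i\<close> grow, it tends to the
  reciprocal of the product side.\<close>

definition quintuple_weight :: "'a::field \<Rightarrow> 'a \<Rightarrow> nat \<Rightarrow> nat \<Rightarrow> 'a" where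
  "quintuple_weight q x a i =
     qbinom q (2 * a - 1) i * qpoch x q a * qpoch (q / x) q a
       / (qpoch (x\<^sup>2) q i * qpoch (q / x\<^sup>2) q (2 * a - i))"

lemma int_choose_two: "2 * int (Suc n choose 2) = int n * (int n + 1)"
  by (induction n) (simp_all add: numeral_2_eq_2 algebra_simps)

text \<open>Collects the signs and powers left by reflecting a numerator of length \<open>a\<close>
  and a denominator of length \<open>j = 2a - i\<close>; everything depends only on
  \<open>k = i - a\<close>.\<close>

lemma recentred_scalar:
  fixes x q :: "'a::field"
  assumes "x \<noteq> 0" "q \<noteq> 0" and ij: "i + j = 2 * a"
  shows "(- x) ^ a / q ^ (Suc a choose 2) / ((- (x\<^sup>2)) ^ j / q ^ (Suc j choose 2)) * (x / q ^ a) ^ i * q ^ (i\<^sup>2)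
    = (-1) powi (int i - int a) * x powi (3 * (int i - int a))
       * q powi ((int i - int a) * (3 * (int i - int a) - 1) div 2)"
proof -
  define k where "k = int i - int a"
  have ia: "int i = int a + k" and ja: "int j = int a - k" using ij by (auto simp: k_def)
  have ex: "k * (3 * k - 1) div 2 = - int (Suc a choose 2) + int (Suc j choose 2) - int (a * i) + int (i\<^sup>2)"
  proof -
    have "2 * (- int (Suc a choose 2) + int (Suc j choose 2) - int (a * i) + int (i\<^sup>2)) = k * (3 * k - 1)"
      using int_choose_two[of a] int_choose_two[of j]
      by (simp add: ia ja power2_eq_square algebra_simps)
    then show ?thesis by (metis nonzero_mult_div_cancel_left zero_neq_numeral)
  qed
  have m1: "(- x) ^ a / (- (x\<^sup>2)) ^ j * x ^ i = (-1) powi k * x powi (3 * k)"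
  proof -
    have "(- x) ^ a / (- (x\<^sup>2)) ^ j * x ^ i = ((-1) ^ a / (-1) ^ j) * (x ^ a / x ^ (2 * j) * x ^ i)"
      by (simp add: power_minus[of x a] power_minus[of "x\<^sup>2" j] power_mult)
    also have "(-1) ^ a / (-1) ^ j = ((-1) powi (int a - int j) :: 'a)"
      by (simp add: power_int_diff)
    also have "x ^ a / x ^ (2 * j) * x ^ i = x powi (int a - int (2 * j) + int i)"
      using assms by (simp add: power_int_diff power_int_add del: of_nat_mult)
    also have "int a - int j = k"
      using ja by simp
    also have "int a - int (2 * j) + int i = 3 * k"
      using ia ja by simp
    finally show ?thesis .
  qed
  have m2: "q ^ (Suc j choose 2) / q ^ (Suc a choose 2) / q ^ (a * i) * q ^ (i\<^sup>2)
     = q powi (k * (3 * k - 1) div 2)"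
    unfolding ex using assms
    by (simp add: power_int_diff power_int_add power_int_minus field_simps del: of_nat_mult of_nat_power)
  show ?thesis
    unfolding k_def[symmetric] m1[symmetric] m2[symmetric]
    using assms by (simp add: power_divide power_mult field_simps)
qed

theorem recentred_finite_quintuple_product:
  fixes x q :: "'a::field"
  assumes nr: "\<And>n. n > 0 \<Longrightarrow> q ^ n \<noteq> 1" and q: "q \<noteq> 0" and x: "x \<noteq> 0"
    and nz: "\<And>n::int. x\<^sup>2 * q powi n \<noteq> 1" and a: "a > 0"
  shows "(\<Sum>i<2*a. quintuple_term q x (int i - int a) * quintuple_weight q x a i) = 1"
proof -
  \<comment> \<open>Shifting \<open>x\<close> by \<open>q^(-a)\<close> produces negative exponents,
    hence the hypothesis over all integers.\<close>
  have nz1: "(x / q ^ a)\<^sup>2 * q ^ n \<noteq> 1" for n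
    using nz[of "int n - int (2 * a)"] q
    by (simp add: power_int_diff power_divide power_mult[symmetric] mult.commute del: of_nat_mult)
  have "quintuple_summand q (x / q ^ a) (2 * a - 1) i
      = quintuple_term q x (int i - int a) * quintuple_weight q x a i" if "i < 2 * a" for i
  proof -
    define j where "j = 2 * a - i"
    have ij: "i + j = 2 * a" using that by (simp add: j_def)
    have e: "Suc (2 * a - 1) = 2 * a" using a by simp
    \<comment> \<open>The numerator is cut at its middle: the first \<open>a\<close> factors are
      reflected, the others form \<open>qpoch x q a\<close>. The denominator below is cut after
      \<open>j\<close> factors in the same way.\<close>
    have d: "qpoch (x / q ^ a) q (2 * a) = (- x) ^ a / q ^ (Suc a choose 2) * qpoch (q / x) q a * qpoch x q a"
      using qpoch_reflect[OF x q, of a] qpoch_add[of "x / q ^ a" q a a] q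
      unfolding mult_2 by (simp add: field_simps)
    have "(x / q ^ a)\<^sup>2 * q ^ i = x\<^sup>2 / q ^ j"
      using q ij by (simp add: power_divide power_mult[symmetric] field_simps flip: power_add)
    moreover have "qpoch (x\<^sup>2 / q ^ j) q (2 * a)
        = (- (x\<^sup>2)) ^ j / q ^ (Suc j choose 2) * qpoch (q / x\<^sup>2) q j * qpoch (x\<^sup>2) q i"
      using qpoch_reflect[of "x\<^sup>2" q j] qpoch_add[of "x\<^sup>2 / q ^ j" q j i] q x ij
      by (simp add: field_simps add.commute)
    moreover have "x / q ^ a * q ^ i = x * q powi (int i - int a)"
      using q by (simp add: power_int_diff)
    ultimately have "quintuple_summand q (x / q ^ a) (2 * a - 1) i =
      (1 + x * q powi (int i - int a)) * qbinom q (2 * a - 1) i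
       * ((- x) ^ a / q ^ (Suc a choose 2) * qpoch (q / x) q a * qpoch x q a)
       / ((- (x\<^sup>2)) ^ j / q ^ (Suc j choose 2) * qpoch (q / x\<^sup>2) q j * qpoch (x\<^sup>2) q i)
       * (x / q ^ a) ^ i * q ^ (i\<^sup>2)"
      unfolding quintuple_summand_def e d by simp
    also have "\<dots> = ((- x) ^ a / q ^ (Suc a choose 2) / ((- (x\<^sup>2)) ^ j / q ^ (Suc j choose 2)) * (x / q ^ a) ^ i * q ^ (i\<^sup>2))
       * (1 + x * q powi (int i - int a)) * quintuple_weight q x a i"
      unfolding quintuple_weight_def j_def by (simp add: mult_ac)
    also have "\<dots> = quintuple_term q x (int i - int a) * quintuple_weight q x a i"
      unfolding recentred_scalar[OF x q ij] quintuple_term_def by (simp add: mult_ac)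
    finally show ?thesis .
  qed
  moreover have "{..2 * a - 1} = {..<2*a}" using a by auto
  ultimately show ?thesis
    using finite_quintuple_product[OF nr nz1, of "2 * a - 1"] by simp
qed

section \<open>Infinite q-Pochhammer symbols: convergence, bounds, continuity\<close>

definition qpoch_inf :: "complex \<Rightarrow> complex \<Rightarrow> complex" where
  "qpoch_inf a q = (\<Prod>n. 1 - a * q ^ n)"

text \<open>The term is \<open>(c * r^n)^n\<close>, and \<open>c * r^n\<close> tends to 0, so
  \<open>(1/2)^n\<close> eventually dominates however large \<open>c\<close> is.\<close>

lemma summable_mult_power_square:
  fixes c r :: real
  assumes "0 \<le> r" "r < 1" "c \<ge> 0"
  shows "summable (\<lambda>n. c ^ n * r ^ (n\<^sup>2))"
proof (rule summable_comparison_test_ev)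
  have "(\<lambda>n. c * r ^ n) \<longlonglongrightarrow> c * 0"
    using assms by (intro tendsto_intros LIMSEQ_realpow_zero) auto
  then have "\<forall>\<^sub>F n in sequentially. c * r ^ n < 1 / 2"
    by (rule order_tendstoD) simp
  then show "\<forall>\<^sub>F n in sequentially. norm (c ^ n * r ^ (n\<^sup>2)) \<le> (1 / 2) ^ n"
  proof eventually_elim
    case (elim n)
    have "c ^ n * r ^ (n\<^sup>2) = (c * r ^ n) ^ n"
      by (simp add: power_mult_distrib power2_eq_square power_mult)
    also have "\<dots> \<le> (1 / 2) ^ n" using elim assms by (intro power_mono) auto
    finally show ?case using assms by simp
  qed
qed (simp add: summable_geometric)

context
  fixes q :: complex
  assumes norm_q: "norm q < 1"
begin

lemma convergent_prod_qpoch: "convergent_prod (\<lambda>n. 1 - a * q ^ n)"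
proof (rule abs_convergent_prod_imp_convergent_prod)
  have "summable (\<lambda>n. norm (a * q ^ n))"
    using norm_q by (auto simp: norm_mult norm_power intro!: summable_mult summable_geometric)
  then show "abs_convergent_prod (\<lambda>n. 1 - a * q ^ n)"
    by (simp add: abs_convergent_prod_conv_summable)
qed

lemma qpoch_LIMSEQ: "qpoch a q \<longlonglongrightarrow> qpoch_inf a q"
  unfolding qpoch_def[abs_def] qpoch_inf_def
  using convergent_prod_qpoch has_prod_imp_tendsto' convergent_prod_has_prod_iff by blast

lemma qpoch_tendsto:
  assumes "filterlim f at_top F"
  shows "((\<lambda>n. qpoch a q (f n)) \<longlongrightarrow> qpoch_inf a q) F"
  using qpoch_LIMSEQ assms by (rule filterlim_compose)

lemma qpoch_inf_nonzero: "(\<And>n. a * q ^ n \<noteq> 1) \<Longrightarrow> qpoch_inf a q \<noteq> 0"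
  unfolding qpoch_inf_def by (rule prodinf_nonzero[OF convergent_prod_qpoch]) auto

lemma qpoch_bounded: "\<exists>C. \<forall>n. norm (qpoch a q n) \<le> C"
  using convergentI[OF qpoch_LIMSEQ, THEN convergent_imp_Bseq] unfolding Bseq_def by blast

text \<open>The infinite product is nonzero, so the inverses converge and are therefore
  bounded.\<close>

lemma inverse_qpoch_bounded:
  assumes "\<And>n. a * q ^ n \<noteq> 1"
  shows "\<exists>C. \<forall>n. norm (inverse (qpoch a q n)) \<le> C"
  using convergentI[OF tendsto_inverse[OF qpoch_LIMSEQ qpoch_inf_nonzero], of a, THEN convergent_imp_Bseq]
    assms unfolding Bseq_def by blast

lemma qpoch_inf_head: "qpoch_inf a q = (1 - a) * qpoch_inf (a * q) q"
proof (rule LIMSEQ_unique)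
  show "(\<lambda>n. qpoch a q (Suc n)) \<longlonglongrightarrow> qpoch_inf a q"
    using qpoch_LIMSEQ by (rule LIMSEQ_Suc)
  have "(\<lambda>n. (1 - a) * qpoch (a * q) q n) \<longlonglongrightarrow> (1 - a) * qpoch_inf (a * q) q"
    by (intro tendsto_intros qpoch_LIMSEQ)
  then show "(\<lambda>n. qpoch a q (Suc n)) \<longlonglongrightarrow> (1 - a) * qpoch_inf (a * q) q"
    using qpoch_add[of a q 1] by (simp add: qpoch_Suc)
qed

text \<open>On a closed ball of radius \<open>R\<close> the partial products converge uniformly,
  with majorant \<open>R * norm q ^ n\<close> for the deviations of the factors from 1.\<close>

lemma isCont_qpoch_inf: "isCont (\<lambda>a. qpoch_inf a q) a"
proof -
  define R where "R = norm a + 1"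
  have "uniform_limit (cball 0 R) (\<lambda>N a. \<Prod>n<N. 1 - a * q ^ n) (\<lambda>a. lim (\<lambda>N. \<Prod>n<N. 1 - a * q ^ n)) sequentially"
    unfolding uniformly_convergent_uniform_limit_iff[symmetric]
  proof (rule uniformly_convergent_on_prod')
    show "uniformly_convergent_on (cball 0 R) (\<lambda>N a. \<Sum>n<N. norm (1 - a * q ^ n - 1))"
    proof (rule Weierstrass_m_test')
      show "norm (norm (1 - a * q ^ n - 1)) \<le> R * norm q ^ n" if "a \<in> cball 0 R" for a n
        using that by (simp add: norm_mult norm_power mult_right_mono)
      show "summable (\<lambda>n. R * norm q ^ n)"
        using norm_q by (intro summable_mult summable_geometric) simp
    qed
  qed (auto intro!: continuous_intros)
  also have "(\<lambda>a. lim (\<lambda>N. \<Prod>n<N. 1 - a * q ^ n)) = (\<lambda>a. qpoch_inf a q)"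
    using qpoch_LIMSEQ by (auto simp: qpoch_def[abs_def] limI)
  finally have "continuous_on (cball 0 R) (\<lambda>a. qpoch_inf a q)"
    by (rule uniform_limit_theorem[rotated]) (auto intro!: always_eventually continuous_intros)
  then have "continuous_on (ball 0 R) (\<lambda>a. qpoch_inf a q)"
    by (rule continuous_on_subset) auto
  then show ?thesis
    by (subst (asm) continuous_on_eq_continuous_at) (auto simp: R_def)
qed

end

text \<open>The two exponents of \<open>q\<close>, namely \<open>k(3k-1)/2\<close> and
  \<open>k(3k+1)/2\<close>, are both at least \<open>k^2\<close>, because
  \<open>\<bar>k\<bar> \<le> k^2\<close> for integers.\<close>

lemma norm_quintuple_term_le:
  fixes q x :: complex
  assumes q: "norm q < 1" "q \<noteq> 0" and x: "x \<noteq> 0"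
  shows "norm (quintuple_term q x k) \<le> (1 + norm x) * norm x powi (3 * k) * norm q ^ nat (k\<^sup>2)"
proof -
  define e where "e = k * (3 * k - 1) div 2"
  have "even (k * (3 * k - 1))" by simp
  then have e2: "2 * e = k * (3 * k - 1)" by (simp add: e_def)
  have "\<bar>k\<bar> * 1 \<le> \<bar>k\<bar> * \<bar>k\<bar>"
    by (cases "k = 0") (auto intro!: mult_left_mono simp del: abs_mult_self_eq)
  then have "k \<le> k * k" "- k \<le> k * k"
    by auto
  moreover have "2 * e = 3 * (k * k) - k"
    using e2 by (simp add: algebra_simps)
  ultimately have le: "k\<^sup>2 \<le> e" "k\<^sup>2 \<le> e + k"
    unfolding power2_eq_square by linarith+
  have *: "norm q powi n \<le> norm q ^ nat (k\<^sup>2)" if "k\<^sup>2 \<le> n" for n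
  proof -
    have "norm q powi n = norm q ^ nat n" using that by (intro power_int_nonneg_exp) (smt (verit) zero_le_power2)
    also have "\<dots> \<le> norm q ^ nat (k\<^sup>2)" using that q by (intro power_decreasing) auto
    finally show ?thesis .
  qed
  have "quintuple_term q x k = (-1) powi k * x powi (3 * k) * (q powi e + x * q powi (e + k))"
    using q by (simp add: quintuple_term_def e_def power_int_add algebra_simps)
  then have "norm (quintuple_term q x k) = norm x powi (3 * k) * norm (q powi e + x * q powi (e + k))"
    by (simp add: norm_mult norm_power_int)
  also have "\<dots> \<le> norm x powi (3 * k) * (norm q ^ nat (k\<^sup>2) + norm x * norm q ^ nat (k\<^sup>2))"
  proof (intro mult_left_mono norm_triangle_le add_mono)
    show "norm (q powi e) \<le> norm q ^ nat (k\<^sup>2)"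
      using *[OF le(1)] by (simp add: norm_power_int)
    show "norm (x * q powi (e + k)) \<le> norm x * norm q ^ nat (k\<^sup>2)"
      using *[OF le(2)] by (simp add: norm_mult norm_power_int mult_left_mono)
  qed auto
  finally show ?thesis by (simp add: algebra_simps)
qed

lemma summable_norm_quintuple_term:
  fixes q x :: complex
  assumes q: "norm q < 1" "q \<noteq> 0" and x: "x \<noteq> 0"
  shows "summable (\<lambda>k. norm (quintuple_term q x (int k)))"
    and "summable (\<lambda>k. norm (quintuple_term q x (- 1 - int k)))"
proof -
  note S = summable_mult[OF summable_mult_power_square[of "norm q"], of _ "1 + norm x"]
  show "summable (\<lambda>k. norm (quintuple_term q x (int k)))"
  proof (rule summable_comparison_test')
    show "summable (\<lambda>k. (1 + norm x) * ((norm x ^ 3) ^ k * norm q ^ (k\<^sup>2)))"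
      using q by (intro S) auto
    show "norm (norm (quintuple_term q x (int k))) \<le> (1 + norm x) * ((norm x ^ 3) ^ k * norm q ^ (k\<^sup>2))" for k
    proof -
      have "norm x powi (3 * int k) = (norm x ^ 3) ^ k"
        unfolding power_int_mult by simp
      moreover have "nat ((int k)\<^sup>2) = k\<^sup>2"
        by (simp flip: of_nat_power)
      ultimately show ?thesis
        using norm_quintuple_term_le[OF q x, of "int k"] by (simp add: mult.assoc)
    qed
  qed
  show "summable (\<lambda>k. norm (quintuple_term q x (- 1 - int k)))"
  proof (rule summable_comparison_test')
    show "summable (\<lambda>k. (1 + norm x) * ((inverse (norm x ^ 3)) ^ Suc k * norm q ^ ((Suc k)\<^sup>2)))"
      using q by (subst summable_Suc_iff) (intro S, auto)
    show "norm (norm (quintuple_term q x (- 1 - int k)))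
        \<le> (1 + norm x) * ((inverse (norm x ^ 3)) ^ Suc k * norm q ^ ((Suc k)\<^sup>2))" for k
    proof -
      have 1: "- 1 - int k = - int (Suc k)" by simp
      have "norm x powi (3 * - int (Suc k)) = inverse (norm x ^ 3) ^ Suc k"
        unfolding power_int_mult power_int_minus by (simp add: power_inverse del: power_Suc of_nat_Suc)
      moreover have "nat ((- int (Suc k))\<^sup>2) = (Suc k)\<^sup>2"
        by (simp del: of_nat_Suc add: nat_power_eq)
      ultimately show ?thesis
        using norm_quintuple_term_le[OF q x, of "- int (Suc k)"] unfolding 1 
        by (simp add: mult.assoc del: power_Suc of_nat_Suc)
    qed
  qed
qed

text \<open>Folds the sum about its middle. After recentring by \<open>a\<close>, the two partners
  are the indices \<open>k\<close> and \<open>-1-k\<close>.\<close>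

lemma sum_pair_centre:
  fixes g :: "nat \<Rightarrow> 'b::comm_monoid_add"
  shows "(\<Sum>i<2 * a. g i) = (\<Sum>k<a. g (a + k) + g (a - 1 - k))"
proof -
  have "(\<Sum>i<2 * a. g i) = (\<Sum>i<a. g i) + (\<Sum>i=a..<a+a. g i)"
    by (simp add: mult_2 lessThan_atLeast0 sum.atLeastLessThan_concat)
  also have "(\<Sum>i=a..<a+a. g i) = (\<Sum>k<a. g (a + k))"
    using sum.shift_bounds_nat_ivl[of g 0 a a] by (simp add: lessThan_atLeast0 add.commute)
  also have "(\<Sum>i<a. g i) = (\<Sum>k<a. g (a - 1 - k))"
    using sum.nat_diff_reindex[of g a] by simp
  finally show ?thesis by (simp add: sum.distrib add.commute)
qed

section \<open>Passage to the limit in the recentred identity\<close>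

context
  fixes q x :: complex
  assumes norm_q: "norm q < 1" and q: "q \<noteq> 0" and x: "x \<noteq> 0"
    and nz: "\<And>n::int. x\<^sup>2 * q powi n \<noteq> 1"
begin

lemma not_root_of_unity: "n > 0 \<Longrightarrow> q ^ n \<noteq> 1"
  using norm_q power_less_one_iff[of "norm q" n] norm_power[of q n] by fastforce

text \<open>The first claim says that \<open>q\<close> is not a root of unity. A failure of any
  other would make \<open>x^2\<close> an integer power of \<open>q\<close>, against
  \<open>nz\<close>.\<close>

lemma nonzero_factors:
  shows "q * q ^ n \<noteq> 1" "x * q ^ n \<noteq> 1" "q / x * q ^ n \<noteq> 1" "x\<^sup>2 * q ^ n \<noteq> 1" "q / x\<^sup>2 * q ^ n \<noteq> 1"
proof -
  show "q * q ^ n \<noteq> 1" using not_root_of_unity[of "Suc n"] by simp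
  have "(x * q ^ n)\<^sup>2 = x\<^sup>2 * q powi (int n * 2)"
    unfolding power_int_mult by (simp add: power_mult_distrib)
  then show "x * q ^ n \<noteq> 1" using nz[of "int n * 2"] by auto
  have "(x / (q * q ^ n))\<^sup>2 = x\<^sup>2 * q powi (- (int (Suc n) * 2))"
    unfolding power_int_minus power_int_mult by (simp add: power_mult_distrib power_inverse divide_inverse del: of_nat_Suc)
  then have "x / (q * q ^ n) \<noteq> 1" using nz[of "- (int (Suc n) * 2)"] by auto
  then show "q / x * q ^ n \<noteq> 1" using x q by (auto simp: field_simps)
  show "x\<^sup>2 * q ^ n \<noteq> 1" using nz[of "int n"] by simp
  have "x\<^sup>2 / (q * q ^ n) = x\<^sup>2 * q powi (- int (Suc n))"
    by (simp add: power_int_minus divide_inverse del: of_nat_Suc)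
  then have "x\<^sup>2 / (q * q ^ n) \<noteq> 1" using nz[of "- int (Suc n)"] by auto
  then show "q / x\<^sup>2 * q ^ n \<noteq> 1" using x q by (auto simp: field_simps)
qed

text \<open>Supplies the uniform majorant for Tannery's theorem: seven factors, each bounded
  independently of its length.\<close>

lemma quintuple_weight_bounded:
  "\<exists>M. \<forall>a i. i < 2 * a \<longrightarrow> norm (quintuple_weight q x a i) \<le> M"
proof -
  obtain C1 where C1: "norm (qpoch q q n) \<le> C1" for n using qpoch_bounded[OF norm_q, of "q"] by blast
  obtain C2 where C2: "norm (inverse (qpoch q q n)) \<le> C2" for n
    using inverse_qpoch_bounded[OF norm_q nonzero_factors(1)] by blast
  obtain C3 where C3: "norm (qpoch x q n) \<le> C3" for n using qpoch_bounded[OF norm_q, of "x"] by blast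
  obtain C4 where C4: "norm (qpoch (q / x) q n) \<le> C4" for n using qpoch_bounded[OF norm_q, of "q / x"] by blast
  obtain C5 where C5: "norm (inverse (qpoch (x\<^sup>2) q n)) \<le> C5" for n
    using inverse_qpoch_bounded[OF norm_q nonzero_factors(4)] by blast
  obtain C6 where C6: "norm (inverse (qpoch (q / x\<^sup>2) q n)) \<le> C6" for n
    using inverse_qpoch_bounded[OF norm_q nonzero_factors(5)] by blast
  have pos: "0 \<le> C1" "0 \<le> C2" "0 \<le> C3" "0 \<le> C4" "0 \<le> C5" "0 \<le> C6"
    using C1[of 0] C2[of 0] C3[of 0] C4[of 0] C5[of 0] C6[of 0] by simp_all
  have "norm (quintuple_weight q x a i) \<le> C1 * C2 * C2 * C3 * C4 * C5 * C6" if "i < 2 * a" for a i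
  proof -
    have "quintuple_weight q x a i = qpoch q q (2*a-1) * inverse (qpoch q q i) * inverse (qpoch q q (2*a-1-i))
        * qpoch x q a * qpoch (q / x) q a * inverse (qpoch (x\<^sup>2) q i) * inverse (qpoch (q / x\<^sup>2) q (2 * a - i))"
      using that by (simp add: quintuple_weight_def qbinom_def divide_inverse mult_ac)
    also have "norm \<dots> \<le> C1 * C2 * C2 * C3 * C4 * C5 * C6"
      unfolding norm_mult by (intro mult_mono C1 C2 C3 C4 C5 C6 mult_nonneg_nonneg norm_ge_zero pos)
    finally show ?thesis .
  qed
  then show ?thesis by blast
qed

lemma quintuple_weight_tendsto:
  fixes a i :: "nat \<Rightarrow> nat"
  assumes "filterlim a at_top F" "filterlim i at_top F" "filterlim (\<lambda>n. 2 * a n - 1 - i n) at_top F"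
  shows "((\<lambda>n. quintuple_weight q x (a n) (i n)) \<longlongrightarrow>
           qpoch_inf x q * qpoch_inf (q / x) q
             / (qpoch_inf q q * qpoch_inf (x\<^sup>2) q * qpoch_inf (q / x\<^sup>2) q)) F"
proof -
  define L where "L = qpoch_inf q q * inverse (qpoch_inf q q) * inverse (qpoch_inf q q)
        * qpoch_inf x q * qpoch_inf (q / x) q * inverse (qpoch_inf (x\<^sup>2) q) * inverse (qpoch_inf (q / x\<^sup>2) q)"
  have 1: "filterlim (\<lambda>n. 2 * a n - 1) at_top F"
    by (rule filterlim_at_top_mono[OF assms(3)]) (auto intro: always_eventually)
  have 2: "filterlim (\<lambda>n. 2 * a n - i n) at_top F"
    by (rule filterlim_at_top_mono[OF assms(3)]) (auto intro: always_eventually)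
  have "((\<lambda>n. qpoch q q (2*a n-1) * inverse (qpoch q q (i n)) * inverse (qpoch q q (2*a n-1-i n))
        * qpoch x q (a n) * qpoch (q / x) q (a n) * inverse (qpoch (x\<^sup>2) q (i n)) * inverse (qpoch (q / x\<^sup>2) q (2 * a n - i n)))
      \<longlongrightarrow> L) F"
    unfolding L_def
    by (intro tendsto_intros qpoch_tendsto qpoch_inf_nonzero norm_q nonzero_factors assms 1 2)
  \<comment> \<open>The third assumption eventually forces \<open>i n < 2 * a n - 1\<close>, which
    selects the quotient branch of \<open>qbinom\<close>.\<close>
  moreover have "\<forall>\<^sub>F n in F. qpoch q q (2*a n-1) * inverse (qpoch q q (i n)) * inverse (qpoch q q (2*a n-1-i n))
        * qpoch x q (a n) * qpoch (q / x) q (a n) * inverse (qpoch (x\<^sup>2) q (i n)) * inverse (qpoch (q / x\<^sup>2) q (2 * a n - i n))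
     = quintuple_weight q x (a n) (i n)"
    using filterlim_at_top[THEN iffD1, OF assms(3), rule_format, of 1]
    by eventually_elim (simp add: quintuple_weight_def qbinom_def divide_inverse mult_ac)
  ultimately have "((\<lambda>n. quintuple_weight q x (a n) (i n)) \<longlongrightarrow> L) F"
    by (rule Lim_transform_eventually)
  also have "L = qpoch_inf x q * qpoch_inf (q / x) q
             / (qpoch_inf q q * qpoch_inf (x\<^sup>2) q * qpoch_inf (q / x\<^sup>2) q)"
    using qpoch_inf_nonzero[OF norm_q nonzero_factors(1)] by (simp add: L_def field_simps)
  finally show ?thesis .
qed

theorem quintuple_product_identity:
  "(\<lambda>k. quintuple_term q x (int k) + quintuple_term q x (- 1 - int k)) sums
     (qpoch_inf q q * qpoch_inf (x\<^sup>2) q * qpoch_inf (q / x\<^sup>2) q / (qpoch_inf x q * qpoch_inf (q / x) q))"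
proof -
  define w where "w = qpoch_inf x q * qpoch_inf (q / x) q
             / (qpoch_inf q q * qpoch_inf (x\<^sup>2) q * qpoch_inf (q / x\<^sup>2) q)"
  have w: "w \<noteq> 0"
    unfolding w_def using nonzero_factors by (auto simp: qpoch_inf_nonzero[OF norm_q])
  obtain M where M: "norm (quintuple_weight q x a i) \<le> M" if "i < 2 * a" for a i
    using quintuple_weight_bounded by metis
  have M0: "M \<ge> 0" using order_trans[OF norm_ge_zero M[of 0 1]] by simp
  let ?h = "quintuple_term q x"
  \<comment> \<open>Here \<open>a = n + 1\<close>, so \<open>a\<close> is positive; the term
    \<open>k\<close> joins the positions \<open>a + k\<close> and \<open>a - 1 - k\<close>. The
    cut-off at \<open>k > n\<close> makes the series over \<open>k\<close> the finite sum, which is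
    1.\<close>
  define f where "f k n = (if k \<le> n then ?h (int k) * quintuple_weight q x (Suc n) (Suc n + k)
     + ?h (- 1 - int k) * quintuple_weight q x (Suc n) (n - k) else 0)" for k n
  have lim: "(f k \<longlongrightarrow> ?h (int k) * w + ?h (- 1 - int k) * w) sequentially" for k
  proof -
    have "(\<lambda>n. ?h (int k) * quintuple_weight q x (Suc n) (Suc n + k)
       + ?h (- 1 - int k) * quintuple_weight q x (Suc n) (n - k))
       \<longlonglongrightarrow> ?h (int k) * w + ?h (- 1 - int k) * w"
      unfolding w_def
    proof (intro tendsto_intros quintuple_weight_tendsto)
      show "filterlim Suc sequentially sequentially" by (rule filterlim_Suc)
      then show "LIM n sequentially. Suc n + k :> sequentially"
        by (rule filterlim_at_top_mono) (auto intro: always_eventually)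
      show "filterlim Suc sequentially sequentially" by (rule filterlim_Suc)
      show *: "LIM n sequentially. n - k :> sequentially"
        by (rule filterlim_minus_const_nat_at_top)
      show "LIM n sequentially. 2 * Suc n - 1 - (Suc n + k) :> sequentially"
        by (rule filterlim_at_top_mono[OF *]) (auto intro: always_eventually)
      show "LIM n sequentially. 2 * Suc n - 1 - (n - k) :> sequentially"
        by (rule filterlim_at_top_mono[OF *]) (auto intro: always_eventually)
    qed
    then show ?thesis
      by (rule Lim_transform_eventually) (use eventually_ge_at_top[of k] in eventually_elim, simp add: f_def)
  qed
  have bound: "norm (f k n) \<le> norm (?h (int k)) * M + norm (?h (- 1 - int k)) * M" for k n
    using M0 unfolding f_def
    by (auto simp: norm_mult intro!: norm_triangle_le add_mono mult_left_mono M)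
  have summ: "summable (\<lambda>k. norm (?h (int k)) * M + norm (?h (- 1 - int k)) * M)"
    by (intro summable_add summable_mult2 summable_norm_quintuple_term norm_q q x)
  have one: "(\<Sum>k. f k n) = 1" for n
  proof -
    have "(\<Sum>k. f k n) = (\<Sum>k<Suc n. f k n)"
      by (rule suminf_finite) (auto simp: f_def)
    also have "\<dots> = (\<Sum>k<Suc n. ?h (int (Suc n + k) - int (Suc n)) * quintuple_weight q x (Suc n) (Suc n + k)
        + ?h (int (Suc n - 1 - k) - int (Suc n)) * quintuple_weight q x (Suc n) (Suc n - 1 - k))"
      by (intro sum.cong refl) (auto simp: f_def of_nat_diff algebra_simps)
    also have "\<dots> = (\<Sum>i<2*Suc n. ?h (int i - int (Suc n)) * quintuple_weight q x (Suc n) i)"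
      by (rule sum_pair_centre[symmetric])
    also have "\<dots> = 1"
      by (rule recentred_finite_quintuple_product) (use not_root_of_unity q x nz in auto)
    finally show ?thesis .
  qed
  have T: "summable (\<lambda>k. norm (?h (int k) * w + ?h (- 1 - int k) * w)) \<and>
        ((\<lambda>n. \<Sum>k. f k n) \<longlongrightarrow> (\<Sum>k. ?h (int k) * w + ?h (- 1 - int k) * w)) sequentially"
  proof -
    have "\<forall>\<^sub>F (k, n) in sequentially \<times>\<^sub>F sequentially.
        norm (f k n) \<le> norm (?h (int k)) * M + norm (?h (- 1 - int k)) * M"
      unfolding case_prod_beta by (intro always_eventually allI bound)
    from tannerys_theorem[OF lim this summ sequentially_bot] show ?thesis
      by (rule conjunct2)
  qed
  have "(\<Sum>k. ?h (int k) * w + ?h (- 1 - int k) * w) = 1"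
    using LIMSEQ_unique[OF conjunct2[OF T, unfolded one] tendsto_const] .
  moreover have "summable (\<lambda>k. ?h (int k) * w + ?h (- 1 - int k) * w)"
    by (rule summable_norm_cancel[OF conjunct1[OF T]])
  ultimately have "(\<lambda>k. (?h (int k) + ?h (- 1 - int k)) * w) sums 1"
    by (simp add: distrib_right sums_iff)
  from sums_divide[OF this, of w] w have "(\<lambda>k. ?h (int k) + ?h (- 1 - int k)) sums (1 / w)"
    by simp
  then show ?thesis by (simp add: w_def)
qed

end

section \<open>The derivative at the zero of the product\<close>

text \<open>The quotient of \<open>y^(m+1) - y^(-m-1)\<close> by \<open>y - 1/y\<close>, which at \<open>y = 1\<close> takes the value \<open>m + 1\<close>.\<close>
definition laurent_char :: "nat \<Rightarrow> 'a::field \<Rightarrow> 'a" where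
  "laurent_char m y = (\<Sum>j\<le>m. y ^ m / y ^ (2 * j))"

text \<open>A geometric sum with ratio \<open>1 / y^2\<close>.\<close>

lemma laurent_char_mult:
  assumes "y \<noteq> 0"
  shows "laurent_char m y * (1 - 1 / y\<^sup>2) = y ^ m - 1 / y ^ (m + 2)"
proof -
  have "laurent_char m y * (1 - 1 / y\<^sup>2) = y ^ m * ((\<Sum>j\<le>m. (1 / y\<^sup>2) ^ j) * (1 - 1 / y\<^sup>2))"
    unfolding laurent_char_def mult.assoc[symmetric] sum_distrib_left
    by (simp add: power_mult power_inverse divide_inverse)
  also have "(\<Sum>j\<le>m. (1 / y\<^sup>2) ^ j) * (1 - 1 / y\<^sup>2) = 1 - (1 / y\<^sup>2) ^ Suc m"
    using sum_gp_basic[of "1 / y\<^sup>2" m] by (simp add: mult.commute)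
  also have "y ^ m * (1 - (1 / y\<^sup>2) ^ Suc m) = y ^ m - y ^ m / y ^ (2 * Suc m)"
    unfolding power_mult power_one_over by (simp add: right_diff_distrib del: power_Suc)
  also have "y ^ m / y ^ (2 * Suc m) = 1 / y ^ (m + 2)"
    using assms by (simp add: divide_simps mult_2 flip: power_add)
  finally show ?thesis .
qed

text \<open>The indices \<open>k\<close> and \<open>-1-k\<close> carry opposite signs and the same
  two powers of \<open>Q\<close>, in exchanged order. Grouping by powers of \<open>Q\<close> leaves
  differences \<open>y^m - 1 / y^(m+2)\<close> with \<open>m = 3k\<close> and
  \<open>m = 3k + 1\<close>.\<close>

lemma quintuple_term_pair:
  fixes Q y :: "'a::field"
  assumes "Q \<noteq> 0" "y \<noteq> 0"
  shows "quintuple_term (Q\<^sup>2) (Q * y) (int k) + quintuple_term (Q\<^sup>2) (Q * y) (- 1 - int k)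
    = (-1) ^ k * (Q ^ (3 * k\<^sup>2 + 2 * k) * laurent_char (3 * k) y
         + Q ^ (3 * k\<^sup>2 + 4 * k + 1) * laurent_char (3 * k + 1) y) * (1 - 1 / y\<^sup>2)"
proof -
  define A where "A = Q ^ (3 * k\<^sup>2 + 2 * k)"
  define B where "B = Q ^ (3 * k\<^sup>2 + 4 * k + 1)"
  have gen: "quintuple_term (Q\<^sup>2) (Q * y) n
     = (-1) powi n * (y powi (3 * n) * Q powi (3 * n\<^sup>2 + 2 * n) + y powi (3 * n + 1) * Q powi (3 * n\<^sup>2 + 4 * n + 1))" for n
  proof -
    define E where "E = n * (3 * n - 1) div 2"
    \<comment> \<open>The base \<open>Q^2\<close> doubles the exponent \<open>E\<close>, so no
      division remains.\<close>
    have e: "n * (3 * n - 1) = 2 * E" unfolding E_def by simp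
    have "quintuple_term (Q\<^sup>2) (Q * y) n = (-1) powi n * (y powi (3 * n) * (Q powi (3 * n) * Q powi (n * (3 * n - 1)))
        + y powi (3 * n) * y * (Q powi (3 * n) * Q powi (n * (3 * n - 1)) * Q * Q powi (2 * n)))"
      unfolding quintuple_term_def E_def[symmetric] e power_int_mult[of Q 2]
      by (simp add: power_int_mult_distrib algebra_simps)
    also have "y powi (3 * n) * y = y powi (3 * n + 1)"
      using assms by (simp add: power_int_add)
    also have "Q powi (3 * n) * Q powi (n * (3 * n - 1)) = Q powi (3 * n\<^sup>2 + 2 * n)"
      unfolding power_int_add[OF disjI1[OF assms(1)], symmetric]
      by (simp add: power2_eq_square algebra_simps)
    also have "Q powi (3 * n\<^sup>2 + 2 * n) * Q * Q powi (2 * n) = Q powi (3 * n\<^sup>2 + 4 * n + 1)"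
      unfolding power_int_add_1[OF disjI1[OF assms(1)], symmetric] power_int_add[OF disjI1[OF assms(1)], symmetric]
      by (simp add: algebra_simps)
    finally show ?thesis .
  qed
  have pos: "quintuple_term (Q\<^sup>2) (Q * y) (int k) = (-1) ^ k * (y ^ (3 * k) * A + y ^ (3 * k + 1) * B)"
  proof -
    have "3 * (int k)\<^sup>2 + 2 * int k = int (3 * k\<^sup>2 + 2 * k)"
      "3 * (int k)\<^sup>2 + 4 * int k + 1 = int (3 * k\<^sup>2 + 4 * k + 1)"
      "3 * int k = int (3 * k)" "int (3 * k) + 1 = int (3 * k + 1)" by simp_all
    then show ?thesis unfolding gen A_def B_def by (simp only: power_int_of_nat)
  qed
  have neg: "quintuple_term (Q\<^sup>2) (Q * y) (- 1 - int k)
      = - ((-1) ^ k * (1 / y ^ (3 * k + 3) * B + 1 / y ^ (3 * k + 2) * A))"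
  proof -
    have 1: "3 * (- 1 - int k)\<^sup>2 + 2 * (- 1 - int k) = int (3 * k\<^sup>2 + 4 * k + 1)"
      by (simp add: power2_eq_square algebra_simps)
    have 2: "3 * (- 1 - int k)\<^sup>2 + 4 * (- 1 - int k) + 1 = int (3 * k\<^sup>2 + 2 * k)"
      by (simp add: power2_eq_square algebra_simps)
    have 3: "3 * (- 1 - int k) = - int (3 * k + 3)" "- int (3 * k + 3) + 1 = - int (3 * k + 2)"
      by simp_all
    have 4: "(-1) powi (- 1 - int k) = - ((-1) ^ k :: 'a)"
    proof -
      have "- 1 - int k = - int (Suc k)" by simp
      then have "(-1) powi (- 1 - int k) = inverse ((-1 :: 'a) ^ Suc k)"
        by (simp only: power_int_minus power_int_of_nat)
      then show ?thesis by (simp flip: power_inverse)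
    qed
    show ?thesis unfolding gen 1 2 3 4 A_def B_def power_int_minus power_int_of_nat
      by (simp only: inverse_eq_divide minus_mult_left)
  qed
  have "quintuple_term (Q\<^sup>2) (Q * y) (int k) + quintuple_term (Q\<^sup>2) (Q * y) (- 1 - int k)
    = (-1) ^ k * (A * (y ^ (3 * k) - 1 / y ^ (3 * k + 2)) + B * (y ^ (3 * k + 1) - 1 / y ^ (3 * k + 1 + 2)))"
    unfolding pos neg by (simp add: algebra_simps numeral_3_eq_3)
  also have "\<dots> = (-1) ^ k * (A * (laurent_char (3 * k) y * (1 - 1 / y\<^sup>2)) + B * (laurent_char (3 * k + 1) y * (1 - 1 / y\<^sup>2)))"
    unfolding laurent_char_mult[OF assms(2)] ..
  finally show ?thesis unfolding A_def B_def by (simp only: distrib_right mult.assoc)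
qed

text \<open>There are \<open>m + 1 \<le> 2^m\<close> summands, each of norm at most
  \<open>2^m\<close>. The bound is uniform in \<open>y\<close>, as Tannery's theorem
  requires.\<close>

lemma norm_laurent_char_le:
  fixes y :: complex
  assumes "1 \<le> norm y" "norm y \<le> 2"
  shows "norm (laurent_char m y) \<le> 4 ^ m"
proof -
  have "norm (laurent_char m y) \<le> (\<Sum>j\<le>m. 2 ^ m)"
    unfolding laurent_char_def
  proof (rule sum_norm_le)
    fix j
    have "norm (y ^ m / y ^ (2 * j)) = norm y ^ m / norm y ^ (2 * j)"
      by (simp add: norm_divide norm_power)
    also have "\<dots> \<le> norm y ^ m / 1"
      using assms by (intro divide_left_mono one_le_power mult_pos_pos zero_less_power) auto
    also have "\<dots> \<le> 2 ^ m" using assms by (simp add: power_mono)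
    finally show "norm (y ^ m / y ^ (2 * j)) \<le> 2 ^ m" .
  qed
  also have "\<dots> = real (Suc m) * 2 ^ m" by simp
  also have "real (Suc m) \<le> 2 ^ m" using less_exp[of m] by (metis Suc_leI of_nat_le_iff of_nat_numeral of_nat_power)
  also have "2 ^ m * 2 ^ m = (4 ^ m :: real)" by (simp flip: power_mult_distrib)
  finally show ?thesis by simp
qed

lemma qpoch_inf_odd_even:
  assumes "norm Q < 1"
  shows "qpoch_inf Q (Q\<^sup>2) * qpoch_inf (Q\<^sup>2) (Q\<^sup>2) = qpoch_inf Q Q"
proof (rule LIMSEQ_unique)
  have Q2: "norm (Q\<^sup>2) < 1" using assms by (simp add: norm_power power_less_one_iff)
  show "(\<lambda>n. qpoch Q (Q\<^sup>2) n * qpoch (Q\<^sup>2) (Q\<^sup>2) n) \<longlonglongrightarrow> qpoch_inf Q (Q\<^sup>2) * qpoch_inf (Q\<^sup>2) (Q\<^sup>2)"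
    by (intro tendsto_intros qpoch_LIMSEQ Q2)
  have "qpoch Q (Q\<^sup>2) n * qpoch (Q\<^sup>2) (Q\<^sup>2) n = qpoch Q Q (2 * n)" for n
  proof (induction n)
    case (Suc n)
    have "Q * (Q\<^sup>2) ^ n = Q * Q ^ (2 * n)" "Q\<^sup>2 * (Q\<^sup>2) ^ n = Q * Q ^ Suc (2 * n)"
      by (simp_all add: power_mult power2_eq_square)
    moreover have "2 * Suc n = Suc (Suc (2 * n))" by simp
    ultimately show ?case
      by (simp only: qpoch_Suc mult.assoc Suc.IH[symmetric]) (simp only: mult_ac)
  qed simp
  moreover have "(\<lambda>n. qpoch Q Q (2 * n)) \<longlonglongrightarrow> qpoch_inf Q Q"
    by (intro qpoch_tendsto assms) (simp add: filterlim_at_top_mono[OF filterlim_ident] always_eventually)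
  ultimately show "(\<lambda>n. qpoch Q (Q\<^sup>2) n * qpoch (Q\<^sup>2) (Q\<^sup>2) n) \<longlonglongrightarrow> qpoch_inf Q Q"
    by simp
qed

lemma quintuple_special:
  fixes Q y :: complex
  assumes Q: "Q \<noteq> 0" and y: "1 < norm y" "norm (Q * y) < 1"
  shows "(\<lambda>k. (-1) ^ k * (Q ^ (3 * k\<^sup>2 + 2 * k) * laurent_char (3 * k) y
         + Q ^ (3 * k\<^sup>2 + 4 * k + 1) * laurent_char (3 * k + 1) y)) sums
    (qpoch_inf (Q\<^sup>2) (Q\<^sup>2) * qpoch_inf (Q\<^sup>2 * y\<^sup>2) (Q\<^sup>2) * qpoch_inf (Q\<^sup>2 / y\<^sup>2) (Q\<^sup>2)
       / (qpoch_inf (Q * y) (Q\<^sup>2) * qpoch_inf (Q / y) (Q\<^sup>2)))"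
proof -
  have y0: "y \<noteq> 0" using y by auto
  have "norm Q * 1 \<le> norm Q * norm y" using y by (intro mult_left_mono) auto
  then have Q1: "norm Q < 1" using y by (simp add: norm_mult)
  then have Q2: "norm (Q\<^sup>2) < 1" by (simp add: norm_power power_less_one_iff)
  \<comment> \<open>The left side is the square of \<open>Q^(n+1) * y\<close>, whose norm is at most
    \<open>norm (Q * y) < 1\<close> for \<open>n \<ge> 0\<close> and at least
    \<open>norm y > 1\<close> for \<open>n < 0\<close>.\<close>
  have nz: "(Q * y)\<^sup>2 * (Q\<^sup>2) powi n \<noteq> 1" for n
  proof -
    have eq: "(Q * y)\<^sup>2 * (Q\<^sup>2) powi n = (Q powi (n + 1) * y)\<^sup>2"
      using Q by (simp add: power_int_add power_mult_distrib power_int_power' power_int_power mult_ac)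
    have "norm (Q powi (n + 1) * y) \<noteq> 1"
    proof (cases "n \<ge> 0")
      case True
      then have "norm Q powi n \<le> 1" using Q1 by (intro power_int_le_one) auto
      then have "norm Q powi n * norm (Q * y) \<le> 1 * norm (Q * y)" by (intro mult_right_mono) auto
      moreover have "norm (Q powi (n + 1) * y) = norm Q powi n * norm (Q * y)"
        using Q by (simp add: norm_mult norm_power_int power_int_add)
      ultimately show ?thesis using y by simp
    next
      case False
      then have "norm Q powi (- (n + 1)) \<le> 1" using Q1 by (intro power_int_le_one) auto
      then have "inverse (norm Q powi (n + 1)) \<le> 1"
        unfolding power_int_minus .
      moreover have "norm Q powi (n + 1) > 0"
        using Q by (intro zero_less_power_int) simp
      ultimately have "norm Q powi (n + 1) \<ge> 1"
        by (simp add: inverse_le_1_iff)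
      then have "1 * norm y \<le> norm (Q powi (n + 1) * y)"
        unfolding norm_mult norm_power_int by (intro mult_right_mono) auto
      then show ?thesis using y by simp
    qed
    then have "Q powi (n + 1) * y \<noteq> 1" "Q powi (n + 1) * y \<noteq> - 1"
      by (metis norm_one, metis norm_one norm_minus_cancel)
    then show ?thesis unfolding eq by (simp add: power2_eq_1_iff)
  qed
  define c where "c = 1 - 1 / y\<^sup>2"
  have c: "c \<noteq> 0"
  proof
    assume "c = 0"
    then have "norm (y\<^sup>2) = 1" using y0 by (simp add: c_def)
    then show False using y by (simp add: norm_power power2_eq_1_iff)
  qed
  \<comment> \<open>The vanishing factor \<open>c\<close> is the head of the product starting at
    \<open>1 / y^2\<close>; it cancels against the factor \<open>c\<close> of each pair.\<close>
  have hd: "qpoch_inf (Q\<^sup>2 / (Q * y)\<^sup>2) (Q\<^sup>2) = c * qpoch_inf (Q\<^sup>2 / y\<^sup>2) (Q\<^sup>2)"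
    using qpoch_inf_head[OF Q2, of "1 / y\<^sup>2"] Q by (simp add: power_mult_distrib c_def)
  have e: "Q\<^sup>2 / (Q * y) = Q / y" "(Q * y)\<^sup>2 = Q\<^sup>2 * y\<^sup>2"
    using Q by (simp_all add: power2_eq_square)
  from quintuple_product_identity[OF Q2 _ _ nz] Q y0
  have "(\<lambda>k. quintuple_term (Q\<^sup>2) (Q * y) (int k) + quintuple_term (Q\<^sup>2) (Q * y) (- 1 - int k)) sums
     (qpoch_inf (Q\<^sup>2) (Q\<^sup>2) * qpoch_inf ((Q * y)\<^sup>2) (Q\<^sup>2) * qpoch_inf (Q\<^sup>2 / (Q * y)\<^sup>2) (Q\<^sup>2)
       / (qpoch_inf (Q * y) (Q\<^sup>2) * qpoch_inf (Q\<^sup>2 / (Q * y)) (Q\<^sup>2)))"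
    by simp
  from sums_divide[OF this, of c] show ?thesis
    unfolding quintuple_term_pair[OF Q y0] c_def[symmetric] hd unfolding e using c by (simp add: mult_ac)
qed

text \<open>The parameter \<open>y = t\<close> is real and decreases to 1. Tannery's theorem gives
  the limit of the series, continuity that of the product side.\<close>

theorem eta_quotient_series:
  fixes Q :: complex
  assumes Q: "Q \<noteq> 0" "norm Q < 1"
  shows "(\<lambda>k. (-1) ^ k * (of_nat (3 * k + 1) * Q ^ (3 * k\<^sup>2 + 2 * k)
         + of_nat (3 * k + 2) * Q ^ (3 * k\<^sup>2 + 4 * k + 1))) sums
    (qpoch_inf (Q\<^sup>2) (Q\<^sup>2) ^ 5 / qpoch_inf Q Q ^ 2)"
proof -
  have Q2: "norm (Q\<^sup>2) < 1" using Q by (simp add: norm_power power_less_one_iff)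
  have nzQ: "qpoch_inf Q (Q\<^sup>2) \<noteq> 0"
  proof (rule qpoch_inf_nonzero[OF Q2])
    fix n
    have "norm (Q ^ Suc (2 * n)) < 1" using Q unfolding norm_power by (subst power_less_one_iff) auto
    then show "Q * (Q\<^sup>2) ^ n \<noteq> 1" by (auto simp: power_mult)
  qed
  have nzQ2: "qpoch_inf (Q\<^sup>2) (Q\<^sup>2) \<noteq> 0"
  proof (rule qpoch_inf_nonzero[OF Q2])
    fix n
    have "norm ((Q\<^sup>2) ^ Suc n) < 1" using Q2 unfolding norm_power by (subst power_less_one_iff) auto
    then show "Q\<^sup>2 * (Q\<^sup>2) ^ n \<noteq> 1" by auto
  qed
  define f where "f k t = (-1) ^ k * (Q ^ (3 * k\<^sup>2 + 2 * k) * laurent_char (3 * k) (of_real t)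
         + Q ^ (3 * k\<^sup>2 + 4 * k + 1) * laurent_char (3 * k + 1) (of_real t))" for k and t :: real
  define b where "b k = (-1) ^ k * (of_nat (3 * k + 1) * Q ^ (3 * k\<^sup>2 + 2 * k)
         + of_nat (3 * k + 2) * Q ^ (3 * k\<^sup>2 + 4 * k + 1))" for k
  define g where "g t = qpoch_inf (Q\<^sup>2) (Q\<^sup>2) * qpoch_inf (Q\<^sup>2 * (of_real t)\<^sup>2) (Q\<^sup>2) * qpoch_inf (Q\<^sup>2 / (of_real t)\<^sup>2) (Q\<^sup>2)
       / (qpoch_inf (Q * of_real t) (Q\<^sup>2) * qpoch_inf (Q / of_real t) (Q\<^sup>2))" for t :: real
  have ev: "\<forall>\<^sub>F t in at_right 1. 1 < t \<and> t \<le> 2 \<and> t * norm Q < 1"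
  proof -
    have "((\<lambda>t. t * norm Q) \<longlongrightarrow> 1 * norm Q) (at_right 1)"
      by (intro tendsto_intros)
    then have "\<forall>\<^sub>F t in at_right 1. t * norm Q < 1"
      by (rule order_tendstoD) (use Q in simp)
    moreover have "\<forall>\<^sub>F t in at_right (1::real). t \<in> {1<..<2}"
      by (rule eventually_at_right_real) simp
    ultimately show ?thesis by eventually_elim auto
  qed
  have lim: "(f k \<longlongrightarrow> b k) (at_right 1)" for k
  proof -
    have "((\<lambda>t. laurent_char m (of_real t :: complex)) \<longlongrightarrow> laurent_char m (of_real 1)) (at_right 1)" for m
      unfolding laurent_char_def by (intro tendsto_intros) auto
    moreover have "laurent_char m (of_real 1 :: complex) = of_nat (m + 1)" for m
      by (simp add: laurent_char_def)
    ultimately have L: "((\<lambda>t. laurent_char m (of_real t :: complex)) \<longlongrightarrow> of_nat (m + 1)) (at_right 1)" for m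
      by metis
    have "(f k \<longlongrightarrow> (-1) ^ k * (Q ^ (3 * k\<^sup>2 + 2 * k) * of_nat (3 * k + 1)
         + Q ^ (3 * k\<^sup>2 + 4 * k + 1) * of_nat (3 * k + 1 + 1))) (at_right 1)"
      unfolding f_def by (intro tendsto_intros L)
    then show ?thesis by (simp add: b_def mult.commute)
  qed
  \<comment> \<open>The constants come from \<open>4^(3k) + 4^(3k+1) = 5 * 64^k\<close>.\<close>
  define M where "M k = 5 * (64 ^ k * norm Q ^ (k\<^sup>2))" for k :: nat
  have M: "norm (f k t) \<le> M k" if "1 < t" "t \<le> 2" for k t
  proof -
    have lc: "norm (laurent_char m (of_real t :: complex)) \<le> 4 ^ m" for m
      by (rule norm_laurent_char_le) (use that in auto)
    have p: "norm (Q ^ n) \<le> norm Q ^ (k\<^sup>2)" if "k\<^sup>2 \<le> n" for n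
      unfolding norm_power using Q that by (intro power_decreasing) auto
    have "norm (f k t) \<le> norm Q ^ (k\<^sup>2) * 4 ^ (3 * k) + norm Q ^ (k\<^sup>2) * 4 ^ (3 * k + 1)"
      unfolding f_def norm_mult[of "(-1) ^ k"] norm_power[of "-1"] norm_minus_cancel norm_one power_one mult_1
      by (intro norm_triangle_le add_mono) (unfold norm_mult, (intro mult_mono p lc; simp)+)
    also have "\<dots> = M k" by (simp add: M_def power_mult)
    finally show ?thesis .
  qed
  have summ: "summable M"
    unfolding M_def using Q by (intro summable_mult summable_mult_power_square) auto
  have T: "summable (\<lambda>k. norm (b k)) \<and> ((\<lambda>t. \<Sum>k. f k t) \<longlongrightarrow> suminf b) (at_right 1)"
  proof -
    have "\<forall>\<^sub>F (k, t) in sequentially \<times>\<^sub>F at_right 1. norm (f k t) \<le> M k"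
      using eventually_prodI[OF eventually_True ev]
      by (rule eventually_mono) (simp add: case_prod_beta M)
    from tannerys_theorem[OF lim this summ trivial_limit_at_right_real] show ?thesis by (rule conjunct2)
  qed
  have fg: "(\<Sum>k. f k t) = g t" if "1 < t" "t * norm Q < 1" for t
    using quintuple_special[OF Q(1), of "of_real t"] that
    unfolding f_def g_def by (simp add: sums_iff norm_mult mult.commute)
  have "(g \<longlongrightarrow> suminf b) (at_right 1)"
    using conjunct2[OF T] by (rule Lim_transform_eventually) (use ev in eventually_elim, simp add: fg)
  moreover have "(g \<longlongrightarrow> g 1) (at_right 1)"
    unfolding g_def using nzQ
    by (intro tendsto_intros isCont_tendsto_compose[OF isCont_qpoch_inf[OF Q2]]) auto
  ultimately have "suminf b = g 1"
    by (rule tendsto_unique[rotated]) simp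
  \<comment> \<open>At \<open>t = 1\<close> the product side is
    \<open>(Q^2; Q^2)^3 / (Q; Q^2)^2\<close>; splitting \<open>(Q; Q)\<close> into odd and even
    powers turns the exponent 3 into 5.\<close>
  also have "g 1 = qpoch_inf (Q\<^sup>2) (Q\<^sup>2) ^ 5 / qpoch_inf Q Q ^ 2"
    unfolding qpoch_inf_odd_even[OF Q(2), symmetric] g_def using nzQ nzQ2
    by (simp add: field_simps power2_eq_square eval_nat_numeral)
  finally have "suminf b = qpoch_inf (Q\<^sup>2) (Q\<^sup>2) ^ 5 / qpoch_inf Q Q ^ 2" .
  with summable_norm_cancel[OF conjunct1[OF T]] show ?thesis
    unfolding b_def by (simp add: sums_iff)
qed

section \<open>The eta quotient\<close>

lemma kronecker_3_eq: "kronecker a 3 = kronecker_prime a 3"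
  by (simp add: kronecker_def prime_factorization_prime)

lemma kronecker_12_eq: "kronecker a 12 = (if even a then 0 else kronecker a 3)"
proof -
  have "prime_factorization (2 * (2 * 3) :: nat) = prime_factorization 2 + prime_factorization (2 * 3)"
    by (rule prime_factorization_mult) simp_all
  also have "prime_factorization (2 * 3 :: nat) = prime_factorization 2 + prime_factorization 3"
    by (rule prime_factorization_mult) simp_all
  finally have "prime_factorization (12 :: nat) = {#2, 2, 3#}"
    by (simp add: prime_factorization_prime)
  then have "kronecker a 12 = (kronecker_prime a 2)\<^sup>2 * kronecker a 3"
    by (simp add: kronecker_def prime_factorization_prime power2_eq_square)
  then show ?thesis by (simp add: kronecker_prime_def)
qed

lemma kronecker_3_cases:
  "kronecker (int (3 * k)) 3 = 0"
  "kronecker (int (3 * k + 1)) 3 = 1"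
  "kronecker (int (3 * k + 2)) 3 = - 1"
proof -
  have L: "kronecker a 3 = Legendre a 3" for a
    by (simp add: kronecker_3_eq kronecker_prime_def)
  show "kronecker (int (3 * k)) 3 = 0"
    by (simp add: L Legendre_def cong_def)
  have "QuadRes 3 (int (3 * k + 1))"
    unfolding QuadRes_def by (intro exI[of _ 1]) (simp add: cong_def)
  then show "kronecker (int (3 * k + 1)) 3 = 1"
    by (simp add: L Legendre_def cong_def)
  have "\<not> QuadRes 3 (int (3 * k + 2))"
  proof
    assume "QuadRes 3 (int (3 * k + 2))"
    then obtain y :: int where y: "y\<^sup>2 mod 3 = 2" by (auto simp: QuadRes_def cong_def)
    have "y mod 3 = 0 \<or> y mod 3 = 1 \<or> y mod 3 = 2" by presburger
    moreover have "y\<^sup>2 mod 3 = (y mod 3)\<^sup>2 mod 3" by (simp add: power_mod)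
    ultimately show False using y by auto
  qed
  then show "kronecker (int (3 * k + 2)) 3 = - 1"
    by (simp add: L Legendre_def cong_def)
qed

text \<open>The coefficient is the symbol modulo 3 for odd \<open>n\<close> and its negative for
  even \<open>n\<close>. Now \<open>3k + 1\<close> is odd exactly for even \<open>k\<close>, and
  \<open>3k + 2\<close> exactly for odd \<open>k\<close>.\<close>

lemma coefficient_cases:
  defines "c \<equiv> \<lambda>n. 2 * kronecker (int n) 12 - kronecker (int n) 3"
  shows "c (3 * k) = 0" "c (3 * k + 1) = (-1) ^ k" "c (3 * k + 2) = (-1) ^ k"
  unfolding c_def kronecker_12_eq kronecker_3_cases by (auto simp: minus_one_power_iff)

lemma dedekind_eta_eq_qpoch_inf:
  "dedekind_eta \<tau> = exp (2 * of_real pi * \<i> * \<tau> / 24)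
     * qpoch_inf (exp (2 * of_real pi * \<i> * \<tau>)) (exp (2 * of_real pi * \<i> * \<tau>))"
  by (simp add: dedekind_eta_def qpoch_inf_def)

theorem theorem2p4:
  fixes \<tau> q :: complex
  assumes "Im \<tau> > 0"
    and "q = exp (2 * of_real pi * \<i> * \<tau>)"
  shows "(\<lambda>k. let n = Suc k in
            of_int ((2 * kronecker (int n) 12 - kronecker (int n) 3) * int n) * q ^ (n\<^sup>2))
         sums (dedekind_eta (6 * \<tau>) ^ 5 / dedekind_eta (3 * \<tau>) ^ 2)"
proof -
  define c where "c n = 2 * kronecker (int n) 12 - kronecker (int n) 3" for n
  note c = coefficient_cases[folded c_def]
  define f where "f n = of_int (c n * int n) * q ^ (n\<^sup>2)" for n
  define Q where "Q = q ^ 3"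
  have q: "q \<noteq> 0" "norm q < 1" using assms by (auto simp: norm_exp_eq_Re)
  have Q: "Q \<noteq> 0" "norm Q < 1" using q by (auto simp: Q_def norm_power power_less_one_iff)
  have eta: "dedekind_eta (6 * \<tau>) ^ 5 / dedekind_eta (3 * \<tau>) ^ 2
      = q * (qpoch_inf (Q\<^sup>2) (Q\<^sup>2) ^ 5 / qpoch_inf Q Q ^ 2)"
  proof -
    define z where "z = 2 * of_real pi * \<i> * \<tau>"
    have "exp (of_nat n * z) = q ^ n" for n
      unfolding assms(2) z_def[symmetric] by (rule exp_of_nat_mult)
    from this[of 3] this[of 6]
    have e: "exp (2 * of_real pi * \<i> * (3 * \<tau>)) = Q" "exp (2 * of_real pi * \<i> * (6 * \<tau>)) = Q\<^sup>2"
      by (simp_all add: z_def Q_def mult_ac flip: power_mult)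
    \<comment> \<open>The exponents agree because
      \<open>5 * 6 / 24 = 1 + 2 * 3 / 24\<close>.\<close>
    have "exp (2 * of_real pi * \<i> * (6 * \<tau>) / 24) ^ 5 = q * exp (2 * of_real pi * \<i> * (3 * \<tau>) / 24) ^ 2"
      unfolding assms(2) exp_of_nat_mult[symmetric] exp_add[symmetric]
      by (rule arg_cong[where f = exp]) simp
    then show ?thesis
      unfolding dedekind_eta_eq_qpoch_inf e by (simp add: power_mult_distrib)
  qed
  \<comment> \<open>Convergence of the ungrouped series needs its own proof, since convergence of
    the blocks of three alone would not give it.\<close>
  have "summable (\<lambda>n. f (Suc n))"
  proof (subst summable_Suc_iff, rule summable_comparison_test')
    show "summable (\<lambda>n. 2 ^ n * norm q ^ (n\<^sup>2))"
      using q by (intro summable_mult_power_square) auto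
    fix n :: nat
    have "n = 3 * (n div 3) \<or> n = 3 * (n div 3) + 1 \<or> n = 3 * (n div 3) + 2" by presburger
    then have "\<bar>c n\<bar> \<le> 1"
      using c[of "n div 3"] by (elim disjE) (metis abs_0 abs_neg_one abs_one power_abs power_one order_refl zero_le_one)+
    then have "\<bar>c n * int n\<bar> \<le> int n"
      by (simp add: abs_mult mult_left_le_one_le)
    also have "\<dots> \<le> 2 ^ n" using less_exp[of n] by (metis less_imp_le of_nat_le_iff of_nat_numeral of_nat_power)
    finally have "norm (of_int (c n * int n) :: complex) \<le> 2 ^ n"
      unfolding norm_of_int by (metis of_int_abs of_int_le_iff of_int_numeral of_int_power)
    then show "norm (f n) \<le> 2 ^ n * norm q ^ (n\<^sup>2)"
      unfolding f_def norm_mult norm_power by (intro mult_right_mono) auto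
  qed
  then obtain s where s: "(\<lambda>n. f (Suc n)) sums s" by (auto simp: summable_def)
  \<comment> \<open>The block holds \<open>3k+1\<close>, \<open>3k+2\<close> and
    \<open>3k+3\<close>, the last with coefficient 0. The squares are
    \<open>1 + 3(3k^2 + 2k)\<close> and \<open>1 + 3(3k^2 + 4k + 1)\<close>, whence the common
    factor \<open>q\<close>.\<close>
  have "(\<Sum>n = k * 3..<k * 3 + 3. f (Suc n)) = q * ((-1) ^ k * (of_nat (3 * k + 1) * Q ^ (3 * k\<^sup>2 + 2 * k)
         + of_nat (3 * k + 2) * Q ^ (3 * k\<^sup>2 + 4 * k + 1)))" for k
  proof -
    have "(\<Sum>n = k * 3..<k * 3 + 3. f (Suc n)) = f (3 * k + 1) + f (3 * k + 2) + f (3 * Suc k)"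
      by (simp add: numeral_3_eq_3 mult.commute)
    moreover have "q ^ (3 * k + 1)\<^sup>2 = q * Q ^ (3 * k\<^sup>2 + 2 * k)"
      unfolding Q_def power_mult[symmetric] power_Suc[symmetric]
      by (rule arg_cong[where f = "power q"]) (simp add: power2_eq_square algebra_simps)
    moreover have "q ^ (3 * k + 2)\<^sup>2 = q * Q ^ (3 * k\<^sup>2 + 4 * k + 1)"
      unfolding Q_def power_mult[symmetric] power_Suc[symmetric]
      by (rule arg_cong[where f = "power q"]) (simp add: power2_eq_square algebra_simps)
    ultimately show ?thesis
      unfolding f_def c by (simp add: algebra_simps)
  qed
  with sums_group[OF s, of 3] sums_mult[OF eta_quotient_series[OF Q], of q]
  have "s = q * (qpoch_inf (Q\<^sup>2) (Q\<^sup>2) ^ 5 / qpoch_inf Q Q ^ 2)"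
    by (simp add: sums_unique2)
  with s show ?thesis
    unfolding eta Let_def f_def c_def by simp
qed

end
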